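(* Let $(X,T)$ be a minimal system. Then any collection of pairwise disjoint non-trivial quasifactors of $(X,T)$ is at most countable.
   Context: A system is a pair $(X,T)$ with $X$ a compact metric space and $T:X\to X$ a homeomorphism. A system is minimal if it contains no proper nonempty closed invariant ($TA=A$) subset. $2^X$ is the space of nonempty closed subsets of $X$ with the Hausdorff metric, on which $T$ acts by $TA=\{Ta:a\in A\}$; $(2^X,T)$ is a system. A quasifactor of $(X,T)$ is a minimal subsystem (closed invariant subset) of $(2^X,T)$; the trivial quasifactor is the fixed point $\{X\}$, and all others are non-trivial. A joining of systems $(X,T)$ and $(Y,S)$ is a closed set $J\subset X\times Y$ with $(T\times S)J=J$ projecting onto $X$ and onto $Y$; the systems are disjoint if $X\times Y$ is their only joining. *)

theory Defs
  imports "HOL-Analysis.Analysis"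
begin

definition system :: "'a metric \<Rightarrow> ('a \<Rightarrow> 'a) \<Rightarrow> bool" where
  "system X T \<longleftrightarrow> compact_space (mtopology_of X) \<and>
     homeomorphic_map (mtopology_of X) (mtopology_of X) T"

definition minimal_system :: "'a metric \<Rightarrow> ('a \<Rightarrow> 'a) \<Rightarrow> bool" where
  "minimal_system X T \<longleftrightarrow> system X T \<and>
     (\<forall>A. closedin (mtopology_of X) A \<and> A \<noteq> {} \<and> T ` A = A \<longrightarrow> A = mspace X)"

definition nonempty_closed_sets :: "'a metric \<Rightarrow> 'a set set" where
  "nonempty_closed_sets X = {A. closedin (mtopology_of X) A \<and> A \<noteq> {}}"

text \<open>The value 0 outside the nonempty closed sets is a junk value: the locale
  \<^locale>\<open>Metric_space\<close> demands nonnegativity and symmetry for all arguments, not only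
  for points of the carrier.\<close>

definition hausdorff_dist :: "'a metric \<Rightarrow> 'a set \<Rightarrow> 'a set \<Rightarrow> real" where
  "hausdorff_dist X A B =
     (if A \<in> nonempty_closed_sets X \<and> B \<in> nonempty_closed_sets X
      then max (SUP a\<in>A. INF b\<in>B. mdist X a b) (SUP b\<in>B. INF a\<in>A. mdist X a b)
      else 0)"

text \<open>The space \<open>2\<^sup>X\<close>. It is meaningful only for compact \<open>X\<close>, where \<^const>\<open>hausdorff_dist\<close>
  is a metric (\<open>Metric_space_hausdorff\<close> below). A map \<open>T\<close> acts on it by
  \<open>(`) T\<close>, that is, by \<open>A \<mapsto> T ` A\<close>.\<close>

definition hyperspace :: "'a metric \<Rightarrow> 'a set metric" where
  "hyperspace X = metric (nonempty_closed_sets X, hausdorff_dist X)"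

definition quasifactor :: "'a metric \<Rightarrow> ('a \<Rightarrow> 'a) \<Rightarrow> 'a set set \<Rightarrow> bool" where
  "quasifactor X T Q \<longleftrightarrow> Q \<noteq> {} \<and> closedin (mtopology_of (hyperspace X)) Q \<and>
     ((`) T) ` Q = Q \<and> minimal_system (submetric (hyperspace X) Q) ((`) T)"

definition joining ::
  "'a metric \<Rightarrow> ('a \<Rightarrow> 'a) \<Rightarrow> 'b metric \<Rightarrow> ('b \<Rightarrow> 'b) \<Rightarrow> ('a \<times> 'b) set \<Rightarrow> bool" where
  "joining X T Y S J \<longleftrightarrow>
     closedin (prod_topology (mtopology_of X) (mtopology_of Y)) J \<and>
     map_prod T S ` J = J \<and> fst ` J = mspace X \<and> snd ` J = mspace Y"

definition disjoint_systems ::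
  "'a metric \<Rightarrow> ('a \<Rightarrow> 'a) \<Rightarrow> 'b metric \<Rightarrow> ('b \<Rightarrow> 'b) \<Rightarrow> bool" where
  "disjoint_systems X T Y S \<longleftrightarrow> (\<forall>J. joining X T Y S J \<longrightarrow> J = mspace X \<times> mspace Y)"

lemma compact_mdist_bounded:
  assumes "compact_space (mtopology_of X)"
  obtains K where "\<And>x y. x \<in> mspace X \<Longrightarrow> y \<in> mspace X \<Longrightarrow> mdist X x y \<le> K"
proof -
  interpret Metric_space "mspace X" "mdist X"
    by (rule Metric_space_mspace_mdist)
  have "compactin mtopology (mspace X)"
    using assms by (simp add: compact_space_def mtopology_of_def)
  then have "mbounded (mspace X)"
    by (rule compactin_imp_mbounded)
  then show thesis
    using that unfolding mbounded_alt by blast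
qed

lemma Metric_space_hausdorff:
  assumes "compact_space (mtopology_of X)"
  shows "Metric_space (nonempty_closed_sets X) (hausdorff_dist X)"
proof -
  interpret Metric_space "mspace X" "mdist X"
    by (rule Metric_space_mspace_mdist)
  obtain K where K: "\<And>x y. x \<in> mspace X \<Longrightarrow> y \<in> mspace X \<Longrightarrow> mdist X x y \<le> K"
    using compact_mdist_bounded[OF assms] by blast
  let ?N = "nonempty_closed_sets X"
  let ?i = "\<lambda>a B. INF b\<in>B. mdist X a b"
  let ?e = "\<lambda>A B. SUP a\<in>A. ?i a B"
  have sub: "A \<subseteq> mspace X" and ne: "A \<noteq> {}" if "A \<in> ?N" for A
    using that closedin_subset[of "mtopology_of X" A] by (auto simp: nonempty_closed_sets_def)
  have bb: "bdd_below (mdist X a ` B)" for a B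
    by (rule bdd_belowI[of _ 0]) auto
  have i_le: "?i a B \<le> mdist X a b" if "b \<in> B" for a b B
    using that bb by (rule cINF_lower[rotated])
  have i_ge: "0 \<le> ?i a B" if "B \<in> ?N" for a B
    using ne[OF that] by (intro cINF_greatest) auto
  have i_K: "?i a B \<le> K" if "a \<in> mspace X" "B \<in> ?N" for a B
    using i_le K that sub ne by (metis ex_in_conv order_trans subsetD)
  have ba: "bdd_above ((\<lambda>a. ?i a B) ` A)" if "A \<in> ?N" "B \<in> ?N" for A B
    by (rule bdd_aboveI[of _ K]) (use that sub i_K in blast)
  have e_ge: "?i a B \<le> ?e A B" if "A \<in> ?N" "B \<in> ?N" "a \<in> A" for a A B
    using that(3) ba[OF that(1,2)] by (rule cSUP_upper)
  have e_nonneg: "0 \<le> ?e A B" if "A \<in> ?N" "B \<in> ?N" for A B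
    using e_ge[OF that] i_ge[OF that(2)] ne[OF that(1)] by (meson ex_in_conv order_trans)
  have hd: "hausdorff_dist X A B = max (?e A B) (?e B A)" if "A \<in> ?N" "B \<in> ?N" for A B
    using that by (simp add: hausdorff_dist_def mdist_commute)
  have e_zero: "A \<subseteq> B" if AB: "A \<in> ?N" "B \<in> ?N" and z: "?e A B \<le> 0" for A B
  proof
    fix a assume a: "a \<in> A"
    have i0: "?i a B \<le> 0"
      using e_ge[OF AB a] z by linarith
    have aX: "a \<in> mspace X"
      using a sub[OF AB(1)] by blast
    have "\<exists>b\<in>B. b \<in> mball a r" if "r > 0" for r
    proof -
      have "?i a B < r" using i0 that by linarith
      then obtain b where "b \<in> B" "mdist X a b < r"
        using cINF_less_iff[OF ne[OF AB(2)] bb] by blast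
      then show ?thesis
        using aX sub[OF AB(2)] by (auto simp: in_mball)
    qed
    then have "a \<in> mtopology closure_of B"
      using aX by (auto simp: metric_closure_of)
    moreover have "closedin mtopology B"
      using AB(2) by (simp add: nonempty_closed_sets_def mtopology_of_def)
    ultimately show "a \<in> B"
      by (simp add: closure_of_closedin)
  qed
  have e_refl: "?e A A \<le> 0" if A: "A \<in> ?N" for A
  proof (rule cSUP_least[OF ne[OF A]])
    fix a assume "a \<in> A"
    then show "?i a A \<le> 0"
      using i_le[of a A a] sub[OF A] by (metis mdist_zero subsetD)
  qed
  have e_tri: "?e A C \<le> ?e A B + ?e B C" if N: "A \<in> ?N" "B \<in> ?N" "C \<in> ?N" for A B C
  proof (rule cSUP_least[OF ne[OF N(1)]])
    fix a assume a: "a \<in> A"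
    have "?i a C - ?e B C \<le> mdist X a b" if b: "b \<in> B" for b
    proof -
      have "?i a C - mdist X a b \<le> mdist X b c" if c: "c \<in> C" for c
      proof -
        have "a \<in> mspace X" "b \<in> mspace X" "c \<in> mspace X"
          using a b c sub N by blast+
        from triangle[OF this] i_le[OF c, of a] show ?thesis by linarith
      qed
      then have "?i a C - mdist X a b \<le> ?i b C"
        by (intro cINF_greatest ne N)
      with e_ge[OF N(2,3) b] show ?thesis by linarith
    qed
    then have "?i a C - ?e B C \<le> ?i a B"
      by (intro cINF_greatest ne N)
    with e_ge[OF N(1,2) a] show "?i a C \<le> ?e A B + ?e B C" by linarith
  qed
  show ?thesis
  proof
    show "0 \<le> hausdorff_dist X A B" for A B
    proof (cases "A \<in> ?N \<and> B \<in> ?N")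
      case True
      then show ?thesis using hd[of A B] e_nonneg[of A B] by simp
    qed (auto simp: hausdorff_dist_def)
    show "hausdorff_dist X A B = hausdorff_dist X B A" for A B
    proof (cases "A \<in> ?N \<and> B \<in> ?N")
      case True
      then show ?thesis using hd[of A B] hd[of B A] by (simp add: max.commute)
    qed (auto simp: hausdorff_dist_def)
    show "hausdorff_dist X A B = 0 \<longleftrightarrow> A = B" if N: "A \<in> ?N" "B \<in> ?N" for A B
    proof
      assume "hausdorff_dist X A B = 0"
      then have "?e A B \<le> 0" "?e B A \<le> 0"
        using hd[OF N] by linarith+
      then show "A = B" using e_zero N by blast
    next
      assume "A = B"
      then show "hausdorff_dist X A B = 0"
        using hd[OF N] e_refl[OF N(1)] e_nonneg[OF N] by simp
    qed
    show "hausdorff_dist X A C \<le> hausdorff_dist X A B + hausdorff_dist X B C"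
      if N: "A \<in> ?N" "B \<in> ?N" "C \<in> ?N" for A B C
      using hd[OF N(1,2)] hd[OF N(2,3)] hd[OF N(1,3)] e_tri[OF N] e_tri[OF N(3,2,1)]
      by linarith
  qed
qed

lemma mspace_hyperspace:
  assumes "compact_space (mtopology_of X)"
  shows "mspace (hyperspace X) = nonempty_closed_sets X"
  unfolding hyperspace_def by (rule Metric_space.mspace_metric[OF Metric_space_hausdorff[OF assms]])

lemma mdist_hyperspace:
  assumes "compact_space (mtopology_of X)"
  shows "mdist (hyperspace X) = hausdorff_dist X"
  unfolding hyperspace_def by (rule Metric_space.mdist_metric[OF Metric_space_hausdorff[OF assms]])

end

theory Submission
  imports Defs
begin

text \<open>
  Choose one member \<open>A\<^sub>Q\<close> of every \<open>Q\<close> in the collection. The heart of the matter is that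
  \<open>A\<^sub>Q\<close> cannot be approximated by the other chosen sets: if for every \<open>\<epsilon> > 0\<close> some
  quasifactor \<open>R\<close> disjoint from \<open>Q\<close> has a member contained in the \<open>\<epsilon>\<close>-neighbourhood of
  \<open>A = A\<^sub>Q\<close>, then \<open>A\<close> is the whole space (\<open>quasifactor_limit_trivial\<close>), and so \<open>Q\<close> is trivial.

  The reason is a bootstrap. Suppose that some orbit segment \<open>y, T y, \<dots>, T\<^sup>n y\<close> lies in \<open>A\<close>.
  Put \<open>y = T x\<close> and take a member \<open>C\<close> of \<open>R\<close> with \<open>x \<in> C\<close>, which exists because the members
  of a quasifactor cover a minimal space. Then \<open>(A, C)\<close> lies in the relation
  \<open>{(B, C) \<in> Q \<times> R. \<exists>x\<in>C. T x, \<dots>, T\<^sup>n\<^sup>+\<^sup>1 x \<in> B}\<close>.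
  This relation is closed, by compactness, and invariant. Being nonempty it is a joining, by
  minimality of \<open>Q\<close> and \<open>R\<close>, and so it is all of \<open>Q \<times> R\<close>, by disjointness
  (\<open>disjoint_quasifactors_common_orbit\<close>). In particular it
  relates \<open>A\<close> to the member of \<open>R\<close> near \<open>A\<close>, which yields a point \<open>\<epsilon>\<close>-close to \<open>A\<close> whose next
  \<open>n + 1\<close> iterates lie in \<open>A\<close>. As \<open>\<epsilon>\<close> tends to \<open>0\<close>, such points accumulate at a point of \<open>A\<close>, and
  \<open>A\<close> contains an orbit segment that is longer by one step. Hence \<open>A\<close> contains arbitrarily
  long orbit segments, by compactness a whole forward orbit, and by minimality everything.

  So each \<open>A\<^sub>Q\<close> has a gap \<open>1/(n+1)\<close> to all the other chosen sets. For a fixed \<open>n\<close> only finitely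
  many sets can be separated in this way, because a compact space is totally bounded
  (\<open>finite_separated_sets\<close>). Summing over \<open>n\<close> gives countability.
\<close>

section \<open>Minimal systems and their disjointness\<close>

lemma minimal_systemD:
  assumes "minimal_system X T"
  shows minimal_system_compact: "compact_space (mtopology_of X)"
    and minimal_system_homeomorphic: "homeomorphic_map (mtopology_of X) (mtopology_of X) T"
    and minimal_system_surj: "T ` mspace X = mspace X"
    and minimal_system_inj: "inj_on T (mspace X)"
    and minimal_system_eq: "\<And>A. closedin (mtopology_of X) A \<Longrightarrow> A \<noteq> {} \<Longrightarrow> T ` A = A \<Longrightarrow> A = mspace X"
  using assms homeomorphic_imp_surjective_map[of "mtopology_of X" "mtopology_of X" T]
    homeomorphic_imp_injective_map[of "mtopology_of X" "mtopology_of X" T]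
  by (auto simp: minimal_system_def system_def)

lemma minimal_system_funpow_mem:
  assumes "minimal_system X T" "x \<in> mspace X"
  shows "(T ^^ n) x \<in> mspace X"
  using assms(2) minimal_system_surj[OF assms(1)] by (induction n) auto

lemma minimal_system_funpow_continuous:
  assumes "minimal_system X T"
  shows "continuous_map (mtopology_of X) (mtopology_of X) (T ^^ n)"
proof (induction n)
  case (Suc n)
  then show ?case
    using homeomorphic_imp_continuous_map[OF minimal_system_homeomorphic[OF assms]]
    by (simp add: continuous_map_compose[unfolded o_def] o_def)
qed (simp add: id_def)

text \<open>The images \<open>T\<^sup>n P\<close> decrease, and their intersection is nonempty by compactness and truly
  invariant.\<close>

lemma minimal_forward_invariant_eq:
  assumes min: "minimal_system X T"
    and P: "closedin (mtopology_of X) P" "P \<noteq> {}" "T ` P \<subseteq> P"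
  shows "P = mspace X"
proof -
  have PX: "P \<subseteq> mspace X"
    using closedin_subset[OF P(1)] by simp
  define N where "N n = (T ^^ n) ` P" for n
  have N_Suc: "N (Suc n) = T ` N n" for n
    by (simp add: N_def image_comp)
  have dec: "N (Suc n) \<subseteq> N n" for n
  proof (induction n)
    case 0
    show ?case using P(3) by (simp add: N_def)
  next
    case (Suc n)
    then show ?case unfolding N_Suc[of "Suc n"] N_Suc[of n] by blast
  qed
  have clo: "closedin (mtopology_of X) (N n)" for n
  proof (induction n)
    case 0
    then show ?case using P(1) by (simp add: N_def)
  next
    case (Suc n)
    then show ?case
      using homeomorphic_imp_closed_map[OF minimal_system_homeomorphic[OF min]]
      by (simp add: N_Suc closed_map_def)
  qed
  have "(\<Inter>n. N n) \<noteq> {}"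
    by (rule compact_space_imp_nest[OF minimal_system_compact[OF min] clo])
      (use P(2) decseq_SucI[of N, OF dec] in \<open>auto simp: N_def[abs_def]\<close>)
  moreover have "T ` (\<Inter>n. N n) = (\<Inter>n. N n)"
  proof -
    have "T ` (\<Inter>n. N n) = (\<Inter>n. T ` N n)"
      by (rule image_INT[OF minimal_system_inj[OF min], where j = 0])
        (use closedin_subset[OF clo] in auto)
    also have "\<dots> = (\<Inter>n. N n)"
      using dec by (auto simp flip: N_Suc)
    finally show ?thesis .
  qed
  ultimately have "(\<Inter>n. N n) = mspace X"
    using minimal_system_eq[OF min] clo by (metis closedin_Inter closedin_INT UNIV_not_empty)
  moreover have "(\<Inter>n. N n) \<subseteq> P"
    using INT_lower[of 0 UNIV N] by (simp add: N_def)
  ultimately show ?thesis using PX by blast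
qed

text \<open>Between compact minimal systems the projection conditions on a joining come for free: a
  projection of a closed invariant set is again closed, along a compact factor, and invariant.
  Hence a single point of a closed invariant relation already determines the relation.\<close>

lemma disjoint_minimal_invariant_eq:
  assumes Y: "minimal_system Y S" and Z: "minimal_system Z U"
    and disj: "disjoint_systems Y S Z U"
    and J: "closedin (prod_topology (mtopology_of Y) (mtopology_of Z)) J"
      "J \<noteq> {}" "map_prod S U ` J = J"
  shows "J = mspace Y \<times> mspace Z"
proof -
  have "fst ` J = mspace Y"
  proof (rule minimal_system_eq[OF Y])
    show "closedin (mtopology_of Y) (fst ` J)"
      using closed_map_fst[OF minimal_system_compact[OF Z]] J(1) by (auto simp: closed_map_def)
    have "S ` fst ` J = fst ` map_prod S U ` J"
      by (simp add: image_comp)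
    then show "S ` fst ` J = fst ` J"
      by (simp add: J(3))
  qed (use J(2) in simp)
  moreover have "snd ` J = mspace Z"
  proof (rule minimal_system_eq[OF Z])
    show "closedin (mtopology_of Z) (snd ` J)"
      using closed_map_snd[OF minimal_system_compact[OF Y]] J(1) by (auto simp: closed_map_def)
    have "U ` snd ` J = snd ` map_prod S U ` J"
      by (simp add: image_comp)
    then show "U ` snd ` J = snd ` J"
      by (simp add: J(3))
  qed (use J(2) in simp)
  ultimately show ?thesis
    using disj J by (auto simp: disjoint_systems_def joining_def)
qed

section \<open>The membership relation on the hyperspace\<close>

lemma nonempty_closed_setsD:
  assumes "A \<in> nonempty_closed_sets X"
  shows "closedin (mtopology_of X) A" "A \<noteq> {}" "A \<subseteq> mspace X"
  using assms closedin_subset[of "mtopology_of X" A] by (auto simp: nonempty_closed_sets_def)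

lemma hausdorff_dist_less_near:
  assumes cpt: "compact_space (mtopology_of X)"
    and AB: "A \<in> nonempty_closed_sets X" "B \<in> nonempty_closed_sets X"
    and less: "hausdorff_dist X A B < e" and a: "a \<in> A"
  obtains b where "b \<in> B" "mdist X a b < e"
proof -
  obtain K where K: "\<And>x y. x \<in> mspace X \<Longrightarrow> y \<in> mspace X \<Longrightarrow> mdist X x y \<le> K"
    using compact_mdist_bounded[OF cpt] by blast
  have sub: "A \<subseteq> mspace X" "B \<subseteq> mspace X" and ne: "B \<noteq> {}"
    using nonempty_closed_setsD[OF AB(1)] nonempty_closed_setsD[OF AB(2)] by auto
  have bb: "bdd_below (mdist X x ` B)" for x
    by (rule bdd_belowI[of _ 0]) auto
  have "bdd_above ((\<lambda>x. INF b\<in>B. mdist X x b) ` A)"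
  proof (rule bdd_aboveI[of _ K])
    fix s assume "s \<in> (\<lambda>x. INF b\<in>B. mdist X x b) ` A"
    then obtain x where x: "x \<in> A" "s = (INF b\<in>B. mdist X x b)" by blast
    obtain b where b: "b \<in> B" using ne by blast
    have "s \<le> mdist X x b" unfolding x(2) by (rule cINF_lower[OF bb b])
    then show "s \<le> K" using K[of x b] x(1) b sub by force
  qed
  then have "(INF b\<in>B. mdist X a b) \<le> (SUP x\<in>A. INF b\<in>B. mdist X x b)"
    by (rule cSUP_upper[OF a])
  also have "\<dots> \<le> hausdorff_dist X A B"
    using AB by (simp add: hausdorff_dist_def)
  finally have "(INF b\<in>B. mdist X a b) < e"
    using less by linarith
  then show thesis
    using that cINF_less_iff[OF ne bb] by blast
qed

text \<open>Every relation between members of quasifactors used below is built from membership by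
  continuous preimages, intersections, and projections along compact factors. Its closedness
  therefore reduces to this fact.\<close>

lemma closedin_membership:
  assumes cpt: "compact_space (mtopology_of X)" and Q: "Q \<subseteq> nonempty_closed_sets X"
  shows "closedin (prod_topology (mtopology_of X) (mtopology_of (submetric (hyperspace X) Q)))
           {(x, B). B \<in> Q \<and> x \<in> B}" (is "closedin (prod_topology ?X ?Q) ?E")
proof -
  interpret X: Metric_space "mspace X" "mdist X"
    by (rule Metric_space_mspace_mdist)
  let ?H = "submetric (hyperspace X) Q"
  interpret H: Metric_space "mspace ?H" "mdist ?H"
    by (rule Metric_space_mspace_mdist)
  have topX: "?X = X.mtopology" and topQ: "?Q = H.mtopology"
    by (simp_all add: mtopology_of_def)
  have spQ: "mspace ?H = Q"
    using Q by (auto simp: mspace_hyperspace[OF cpt])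
  have sub: "B \<subseteq> mspace X" if "B \<in> Q" for B
    using that Q nonempty_closed_setsD(3) by blast
  have "openin (prod_topology ?X ?Q) (mspace X \<times> Q - ?E)"
    unfolding openin_prod_topology_alt
  proof (intro allI impI)
    fix x B assume "(x, B) \<in> mspace X \<times> Q - ?E"
    then have x: "x \<in> mspace X" and B: "B \<in> Q" and xB: "x \<notin> B" by auto
    have "closedin X.mtopology B"
      using B Q by (auto simp: nonempty_closed_sets_def mtopology_of_def)
    then obtain r where r: "r > 0" "disjnt B (X.mball x r)"
      using x xB unfolding X.closedin_metric by blast
    let ?U = "X.mball x (r/2)" and ?V = "H.mball B (r/2)"
    have "(y, C) \<in> mspace X \<times> Q - ?E" if yC: "y \<in> ?U" "C \<in> ?V" for y C
    proof -
      have y: "y \<in> mspace X" "mdist X x y < r/2"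
        using yC(1) by auto
      have "C \<in> Q" "hausdorff_dist X B C < r/2"
        using yC(2)[unfolded H.in_mball, unfolded mdist_submetric mdist_hyperspace[OF cpt] spQ]
        by blast+
      then have C: "C \<in> Q" "hausdorff_dist X C B < r/2"
        using Metric_space.commute[OF Metric_space_hausdorff[OF cpt], of C B] by simp_all
      have "y \<notin> C"
      proof
        assume "y \<in> C"
        then obtain b where b: "b \<in> B" "mdist X y b < r/2"
          by (rule hausdorff_dist_less_near[OF cpt subsetD[OF Q C(1)] subsetD[OF Q B] C(2)])
        then have "mdist X x b < r"
          using X.triangle[OF x y(1), of b] y(2) sub[OF B] by force
        then have "b \<in> X.mball x r"
          using b(1) sub[OF B] x by auto
        then show False
          using r(2) b(1) by (auto simp: disjnt_def)
      qed
      then show ?thesis using y C by simp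
    qed
    moreover have "x \<in> ?U"
      using x r(1) by simp
    moreover have "B \<in> ?V"
      by (rule H.centre_in_mball_iff[THEN iffD2]) (use B r(1) in \<open>simp add: spQ del: mspace_submetric\<close>)
    ultimately show "\<exists>U V. openin ?X U \<and> openin ?Q V \<and> x \<in> U \<and> B \<in> V \<and> U \<times> V \<subseteq> mspace X \<times> Q - ?E"
      unfolding topX topQ using X.openin_mball H.openin_mball by blast
  qed
  then show ?thesis
    using sub spQ by (auto simp: closedin_def topspace_prod_topology simp del: mspace_submetric)
qed

section \<open>Quasifactors of minimal systems\<close>

lemma quasifactorD:
  assumes min: "minimal_system X T" and Q: "quasifactor X T Q"
  shows quasifactor_subset: "Q \<subseteq> nonempty_closed_sets X"
    and quasifactor_mspace: "mspace (submetric (hyperspace X) Q) = Q"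
    and quasifactor_minimal: "minimal_system (submetric (hyperspace X) Q) ((`) T)"
    and quasifactor_image: "(`) T ` Q = Q"
proof -
  show sub: "Q \<subseteq> nonempty_closed_sets X"
    using Q closedin_subset[of "mtopology_of (hyperspace X)" Q]
      mspace_hyperspace[OF minimal_system_compact[OF min]]
    by (auto simp: quasifactor_def)
  then show "mspace (submetric (hyperspace X) Q) = Q"
    using mspace_hyperspace[OF minimal_system_compact[OF min]] by auto
  show "minimal_system (submetric (hyperspace X) Q) ((`) T)" "(`) T ` Q = Q"
    using Q unfolding quasifactor_def by blast+
qed

lemma quasifactor_member:
  assumes min: "minimal_system X T" and Q: "quasifactor X T Q" and A: "A \<in> Q"
  shows "closedin (mtopology_of X) A" "A \<noteq> {}" "A \<subseteq> mspace X"
  using nonempty_closed_setsD quasifactor_subset[OF min Q] A by blast+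

lemma quasifactor_Union:
  assumes min: "minimal_system X T" and Q: "quasifactor X T Q"
  shows "\<Union>Q = mspace X"
proof (rule minimal_system_eq[OF min])
  let ?E = "{(x, B). B \<in> Q \<and> x \<in> B}"
  have "closedin (mtopology_of X) (fst ` ?E)"
    using closed_map_fst[OF minimal_system_compact[OF quasifactor_minimal[OF min Q]]]
      closedin_membership[OF minimal_system_compact[OF min] quasifactor_subset[OF min Q]]
    by (auto simp: closed_map_def)
  moreover have "fst ` ?E = \<Union>Q"
    by (auto intro!: rev_image_eqI)
  ultimately show "closedin (mtopology_of X) (\<Union>Q)" by simp
  show "\<Union>Q \<noteq> {}"
    using Q quasifactor_member(2)[OF min Q] unfolding quasifactor_def by blast
  have "T ` \<Union>Q = \<Union>((`) T ` Q)" by blast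
  then show "T ` \<Union>Q = \<Union>Q"
    by (simp add: quasifactor_image[OF min Q])
qed

lemma quasifactor_trivial:
  assumes min: "minimal_system X T" and Q: "quasifactor X T Q" and XQ: "mspace X \<in> Q"
  shows "Q = {mspace X}"
proof -
  let ?H = "submetric (hyperspace X) Q"
  interpret H: Metric_space "mspace ?H" "mdist ?H"
    by (rule Metric_space_mspace_mdist)
  have "{mspace X} = mspace ?H"
  proof (rule minimal_system_eq[OF quasifactor_minimal[OF min Q]])
    have "Hausdorff_space (mtopology_of ?H)"
      unfolding mtopology_of_def by (rule H.Hausdorff_space_mtopology)
    then show "closedin (mtopology_of ?H) {mspace X}"
      using XQ quasifactor_mspace[OF min Q]
      by (intro closedin_Hausdorff_singleton) (simp_all del: mspace_submetric)
  qed (use minimal_system_surj[OF min] in auto)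
  then show ?thesis using quasifactor_mspace[OF min Q] by simp
qed

text \<open>The index set \<open>M\<close> describes a pattern of times. That some point visits one particular
  \<open>A\<^sub>0 \<in> Q\<close> at these times propagates to every \<open>A \<in> Q\<close>, and the visiting point can even be
  taken from any prescribed \<open>C \<in> R\<close>: disjointness of \<open>Q\<close> and \<open>R\<close> fills up the
  closed invariant relation that expresses this.\<close>

lemma disjoint_quasifactors_common_orbit:
  assumes min: "minimal_system X T"
    and Q: "quasifactor X T Q" and R: "quasifactor X T R"
    and disj: "disjoint_systems (submetric (hyperspace X) Q) ((`) T)
                                (submetric (hyperspace X) R) ((`) T)"
    and A0: "A\<^sub>0 \<in> Q" and x0: "x\<^sub>0 \<in> mspace X" "\<And>m. m \<in> M \<Longrightarrow> (T ^^ m) x\<^sub>0 \<in> A\<^sub>0"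
    and AC: "A \<in> Q" "C \<in> R"
  shows "\<exists>x\<in>C. \<forall>m\<in>M. (T ^^ m) x \<in> A"
proof -
  let ?X = "mtopology_of X"
  let ?Q = "mtopology_of (submetric (hyperspace X) Q)"
  let ?R = "mtopology_of (submetric (hyperspace X) R)"
  let ?P = "prod_topology ?X (prod_topology ?Q ?R)"
  define W where "W = {(x, B, C). B \<in> Q \<and> C \<in> R \<and> x \<in> C \<and> (\<forall>m\<in>M. (T ^^ m) x \<in> B)}"
  define J where "J = snd ` W"
  have memJ: "(B, C) \<in> J \<longleftrightarrow> B \<in> Q \<and> C \<in> R \<and> (\<exists>x\<in>C. \<forall>m\<in>M. (T ^^ m) x \<in> B)" for B C
    by (force simp: J_def W_def)
  have topP: "topspace ?P = mspace X \<times> Q \<times> R"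
    using quasifactor_mspace[OF min Q] quasifactor_mspace[OF min R]
    by (simp del: mspace_submetric)
  have memQ: "closedin (prod_topology ?X ?Q) {(x, B). B \<in> Q \<and> x \<in> B}"
    and memR: "closedin (prod_topology ?X ?R) {(x, B). B \<in> R \<and> x \<in> B}"
    using closedin_membership[OF minimal_system_compact[OF min]]
      quasifactor_subset[OF min Q] quasifactor_subset[OF min R] by blast+
  have fstP: "continuous_map ?P ?X fst" and QP: "continuous_map ?P ?Q (\<lambda>z. fst (snd z))"
    and RP: "continuous_map ?P ?R (\<lambda>z. snd (snd z))"
    using continuous_map_compose[OF continuous_map_snd continuous_map_fst]
      continuous_map_compose[OF continuous_map_snd continuous_map_snd]
    by (auto simp: o_def continuous_map_fst)
  have clR: "closedin ?P {z \<in> topspace ?P. (fst z, snd (snd z)) \<in> {(x, B). B \<in> R \<and> x \<in> B}}"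
    by (rule closedin_continuous_map_preimage[OF _ memR])
      (intro continuous_map_pairedI fstP RP)
  have clQ: "closedin ?P {z \<in> topspace ?P. ((T ^^ m) (fst z), fst (snd z)) \<in> {(x, B). B \<in> Q \<and> x \<in> B}}" for m
    by (rule closedin_continuous_map_preimage[OF _ memQ])
      (intro continuous_map_pairedI QP
        continuous_map_compose[OF fstP minimal_system_funpow_continuous[OF min], unfolded o_def])
  have "W = {z \<in> topspace ?P. (fst z, snd (snd z)) \<in> {(x, B). B \<in> R \<and> x \<in> B}} \<inter>
     (\<Inter>m\<in>M. {z \<in> topspace ?P. ((T ^^ m) (fst z), fst (snd z)) \<in> {(x, B). B \<in> Q \<and> x \<in> B}})"
    unfolding topP W_def using quasifactor_member(3)[OF min R] by fastforce
  also have "closedin ?P \<dots>"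
  proof (cases "M = {}")
    case False
    then show ?thesis
      by (intro closedin_Int closedin_INT clR clQ)
  qed (use clR in simp)
  finally have "closedin ?P W" .
  then have closed: "closedin (prod_topology ?Q ?R) J"
    unfolding J_def using closed_map_snd[OF minimal_system_compact[OF min]]
    by (auto simp: closed_map_def)
  obtain C0 where "C0 \<in> R" "x\<^sub>0 \<in> C0"
    using quasifactor_Union[OF min R] x0(1) by blast
  then have ne: "J \<noteq> {}"
    using memJ[of A\<^sub>0 C0] A0 x0(2) by blast
  have comm: "(T ^^ m) (T x) = T ((T ^^ m) x)" for m x
    by (simp add: funpow_swap1)
  have inv: "map_prod ((`) T) ((`) T) ` J = J"
  proof (intro equalityI subsetI)
    fix z assume "z \<in> map_prod ((`) T) ((`) T) ` J"
    then obtain B C x where z: "z = (T ` B, T ` C)" and BC: "B \<in> Q" "C \<in> R"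
      and x: "x \<in> C" "\<forall>m\<in>M. (T ^^ m) x \<in> B"
      by (auto simp: memJ)
    have "T ` B \<in> Q" "T ` C \<in> R"
      using BC quasifactor_image[OF min Q] quasifactor_image[OF min R] by blast+
    moreover have "T x \<in> T ` C" "\<forall>m\<in>M. (T ^^ m) (T x) \<in> T ` B"
      using x comm by auto
    ultimately show "z \<in> J"
      unfolding z memJ by blast
  next
    fix z assume "z \<in> J"
    then obtain B C x where z: "z = (B, C)" and BC: "B \<in> Q" "C \<in> R"
      and x: "x \<in> C" "\<forall>m\<in>M. (T ^^ m) x \<in> B"
      by (cases z) (auto simp: memJ)
    have "B \<in> (`) T ` Q" "C \<in> (`) T ` R"
      using BC by (simp_all only: quasifactor_image[OF min Q] quasifactor_image[OF min R])
    then obtain B' C' where B': "B' \<in> Q" "B = T ` B'" and C': "C' \<in> R" "C = T ` C'"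
      by blast
    obtain x' where x': "x' \<in> C'" "x = T x'"
      using x(1) C' by blast
    have x'X: "x' \<in> mspace X"
      using x' C' quasifactor_member(3)[OF min R] by blast
    have "(T ^^ m) x' \<in> B'" if m: "m \<in> M" for m
    proof -
      have "(T ^^ m) (T x') \<in> T ` B'"
        using x(2) m unfolding B'(2) x'(2) by blast
      then have "T ((T ^^ m) x') \<in> T ` B'"
        by (simp only: comm)
      then show ?thesis
        using inj_on_image_mem_iff[OF minimal_system_inj[OF min]
            minimal_system_funpow_mem[OF min x'X] quasifactor_member(3)[OF min Q B'(1)]] by simp
    qed
    then have "(B', C') \<in> J"
      using memJ B' C' x' by blast
    then show "z \<in> map_prod ((`) T) ((`) T) ` J"
      unfolding z using B' C' by force
  qed
  have "J = Q \<times> R"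
    using disjoint_minimal_invariant_eq[OF quasifactor_minimal[OF min Q]
        quasifactor_minimal[OF min R] disj closed ne inv]
      quasifactor_mspace[OF min Q] quasifactor_mspace[OF min R] by simp
  then show ?thesis
    using AC memJ by blast
qed

section \<open>Limits of disjoint quasifactors are trivial\<close>

lemma compact_meets_closed_limit:
  assumes cpt: "compact_space (mtopology_of X)"
    and D: "closedin (mtopology_of X) D" and A: "closedin (mtopology_of X) A"
    and near: "\<And>e. e > 0 \<Longrightarrow> \<exists>x\<in>D. \<exists>a\<in>A. mdist X a x < e"
  shows "D \<inter> A \<noteq> {}"
proof -
  interpret X: Metric_space "mspace X" "mdist X"
    by (rule Metric_space_mspace_mdist)
  have top: "mtopology_of X = X.mtopology" by (simp add: mtopology_of_def)
  have AX: "A \<subseteq> mspace X" and DX: "D \<subseteq> mspace X"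
    using closedin_subset[OF A] closedin_subset[OF D] by auto
  have "\<forall>n. \<exists>x. x \<in> D \<and> (\<exists>a\<in>A. mdist X a x < inverse (Suc n))"
    using near by (metis inverse_positive_iff_positive of_nat_0_less_iff zero_less_Suc)
  then obtain \<sigma> where \<sigma>: "\<And>n. \<sigma> n \<in> D" "\<And>n. \<exists>a\<in>A. mdist X a (\<sigma> n) < inverse (Suc n)"
    by metis
  have "compactin X.mtopology D"
    using closedin_compact_space[OF cpt D] top by simp
  then obtain l r where l: "l \<in> D" and r: "strict_mono r"
    and lim: "limitin X.mtopology (\<sigma> \<circ> r) l sequentially"
    using \<sigma>(1) unfolding X.compactin_sequentially by (metis image_subsetI)
  have lX: "l \<in> mspace X" using l DX by blast
  have "l \<in> A"
  proof (rule ccontr)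
    assume "l \<notin> A"
    then obtain e where e: "e > 0" "disjnt A (X.mball l e)"
      using A lX unfolding top X.closedin_metric by blast
    obtain N where N: "\<And>n. n \<ge> N \<Longrightarrow> mdist X (\<sigma> (r n)) l < e/2"
      using lim e(1) unfolding X.limitin_metric eventually_sequentially
      by (metis comp_apply half_gt_zero)
    obtain k where k: "inverse (Suc k) < e/2"
      using reals_Archimedean[of "e/2"] e(1) by auto
    define n where "n = max N k"
    obtain a where a: "a \<in> A" "mdist X a (\<sigma> (r n)) < inverse (Suc (r n))"
      using \<sigma>(2) by blast
    have "k \<le> r n"
      using seq_suble[OF r, of n] by (simp add: n_def)
    then have "inverse (real (Suc (r n))) \<le> inverse (Suc k)"
      by (simp add: field_simps)
    then have "mdist X a (\<sigma> (r n)) < e/2"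
      using a(2) k by linarith
    moreover have "mdist X (\<sigma> (r n)) l < e/2"
      using N by (simp add: n_def)
    ultimately have "mdist X a l < e"
      using X.triangle[of a "\<sigma> (r n)" l] a(1) AX DX \<sigma>(1) lX by fastforce
    then have "a \<in> X.mball l e"
      using a(1) AX lX X.commute[of a l] by auto
    then show False
      using e(2) a(1) by (auto simp: disjnt_def)
  qed
  then show ?thesis using l by blast
qed

text \<open>The bootstrap described at the top. The closeness of \<open>C\<close> to \<open>A\<close> is one-sided because
  it only has to carry the visiting points, which lie in \<open>C\<close>, towards \<open>A\<close>.\<close>

lemma quasifactor_limit_trivial:
  assumes min: "minimal_system X T" and Q: "quasifactor X T Q" and A: "A \<in> Q"
    and lim: "\<And>e. e > 0 \<Longrightarrow> \<exists>R C. quasifactor X T R \<and>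
      disjoint_systems (submetric (hyperspace X) Q) ((`) T) (submetric (hyperspace X) R) ((`) T) \<and>
      C \<in> R \<and> (\<forall>x\<in>C. \<exists>a\<in>A. mdist X a x < e)"
  shows "A = mspace X"
proof -
  note Acl = quasifactor_member[OF min Q A]
  note cpt = minimal_system_compact[OF min]
  define P where "P M = {x \<in> mspace X. \<forall>m\<in>M. (T ^^ m) x \<in> A}" for M
  have clo: "closedin (mtopology_of X) (P M)" for M
  proof (cases "M = {}")
    case True
    then show ?thesis
      unfolding P_def using closedin_topspace[of "mtopology_of X"] by simp
  next
    case False
    have "P M = (\<Inter>m\<in>M. {x \<in> topspace (mtopology_of X). (T ^^ m) x \<in> A})"
      using False by (auto simp: P_def)
    then show ?thesis
      using closedin_continuous_map_preimage[OF minimal_system_funpow_continuous[OF min] Acl(1)] False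
      by (simp add: closedin_INT)
  qed
  have ne: "P {..n} \<noteq> {}" for n
  proof (induction n)
    case 0
    then show ?case using Acl by (auto simp: P_def)
  next
    case (Suc n)
    then obtain y where y: "y \<in> mspace X" "\<And>m. m \<le> n \<Longrightarrow> (T ^^ m) y \<in> A"
      by (auto simp: P_def)
    obtain x0 where x0: "x0 \<in> mspace X" "y = T x0"
      using y(1) minimal_system_surj[OF min] by blast
    \<comment> \<open>Time \<open>0\<close> is left out of the pattern: it is regained in the limit, from the closeness
        of the visiting points to \<open>A\<close>.\<close>
    let ?M = "{1..Suc n}"
    have x0A: "(T ^^ m) x0 \<in> A" if m: "m \<in> ?M" for m
    proof -
      obtain k where "m = Suc k" "k \<le> n" using m by (cases m) auto
      then show ?thesis using y(2)[of k] x0 by (simp add: funpow_swap1)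
    qed
    have "P ?M \<inter> A \<noteq> {}"
    proof (rule compact_meets_closed_limit[OF cpt clo Acl(1)])
      fix e :: real assume e: "e > 0"
      obtain R C where R: "quasifactor X T R"
        and disj: "disjoint_systems (submetric (hyperspace X) Q) ((`) T)
                                    (submetric (hyperspace X) R) ((`) T)"
        and C: "C \<in> R" "\<forall>x\<in>C. \<exists>a\<in>A. mdist X a x < e"
        using lim[OF e] by blast
      obtain x where "x \<in> C" "\<forall>m\<in>?M. (T ^^ m) x \<in> A"
        using disjoint_quasifactors_common_orbit[OF min Q R disj A x0(1) x0A A C(1)] by blast
      moreover from this have "x \<in> P ?M"
        using quasifactor_member(3)[OF min R C(1)] by (auto simp: P_def)
      ultimately show "\<exists>x\<in>P ?M. \<exists>a\<in>A. mdist X a x < e"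
        using C(2) by blast
    qed
    then obtain x where x: "x \<in> P ?M" "x \<in> A" by blast
    then have "(T ^^ m) x \<in> A" if "m \<le> Suc n" for m
      using that by (cases "m = 0") (auto simp: P_def)
    then show ?case using x Acl(3) by (auto simp: P_def)
  qed
  have "(\<Inter>n. P {..n}) \<noteq> {}"
    by (rule compact_space_imp_nest[OF cpt clo ne]) (auto simp: P_def decseq_def)
  moreover have "(\<Inter>n. P {..n}) \<subseteq> P UNIV"
    by (auto simp: P_def)
  ultimately have neU: "P UNIV \<noteq> {}" by blast
  have "T x \<in> P UNIV" if x: "x \<in> P UNIV" for x
  proof -
    have "(T ^^ m) (T x) \<in> A" for m
    proof -
      have "(T ^^ Suc m) x \<in> A" using x unfolding P_def by blast
      then show ?thesis by (simp add: funpow_swap1)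
    qed
    then show ?thesis
      using x minimal_system_surj[OF min] by (auto simp: P_def)
  qed
  then have "P UNIV = mspace X"
    using minimal_forward_invariant_eq[OF min clo neU] by blast
  moreover have "P UNIV \<subseteq> A"
  proof
    fix x assume "x \<in> P UNIV"
    then have "(T ^^ 0) x \<in> A" unfolding P_def by blast
    then show "x \<in> A" by simp
  qed
  ultimately show ?thesis using Acl(3) by blast
qed

section \<open>Countability\<close>

text \<open>Record which points of a finite \<open>e/2\<close>-net come within \<open>e/2\<close> of \<open>A i\<close>. Two indices with
  the same record would place every point of either set within \<open>e\<close> of the other set.\<close>

lemma finite_separated_sets:
  assumes cpt: "compact_space (mtopology_of X)" and e: "e > 0"
    and sub: "\<And>i. i \<in> I \<Longrightarrow> A i \<subseteq> mspace X"
    and sep: "\<And>i j. i \<in> I \<Longrightarrow> j \<in> I \<Longrightarrow> i \<noteq> j \<Longrightarrow> \<exists>y\<in>A j. \<forall>x\<in>A i. e \<le> mdist X x y"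
  shows "finite I"
proof -
  interpret X: Metric_space "mspace X" "mdist X"
    by (rule Metric_space_mspace_mdist)
  have "compactin X.mtopology (mspace X)"
    using cpt by (simp add: compact_space_def mtopology_of_def)
  then have "X.mtotally_bounded (mspace X)"
    by (rule X.compactin_imp_mtotally_bounded)
  then obtain F where F: "finite F" "F \<subseteq> mspace X" "mspace X \<subseteq> (\<Union>f\<in>F. X.mball f (e/2))"
    using e unfolding X.mtotally_bounded_def by (meson half_gt_zero)
  define code where "code i = {f \<in> F. \<exists>x\<in>A i. mdist X f x < e/2}" for i
  have "inj_on code I"
  proof (rule inj_onI, rule ccontr)
    fix i j assume ij: "i \<in> I" "j \<in> I" "code i = code j" "i \<noteq> j"
    obtain y where y: "y \<in> A j" "\<forall>x\<in>A i. e \<le> mdist X x y"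
      using sep[OF ij(1,2,4)] by blast
    have yX: "y \<in> mspace X" using y(1) sub[OF ij(2)] by blast
    obtain f where f: "f \<in> F" "mdist X f y < e/2"
      using F(3) yX by auto
    then have "f \<in> code i" using y(1) ij(3) by (auto simp: code_def)
    then obtain x where x: "x \<in> A i" "mdist X f x < e/2" by (auto simp: code_def)
    then have "x \<in> mspace X" "f \<in> mspace X" using sub[OF ij(1)] F(2) f(1) by blast+
    then have "mdist X x y < e"
      using X.triangle[of x f y] X.commute[of x f] yX f(2) x(2) by linarith
    then show False using y(2) x(1) by force
  qed
  moreover have "code ` I \<subseteq> Pow F" by (auto simp: code_def)
  ultimately show ?thesis
    using F(1) by (meson finite_Pow_iff inj_on_finite)
qed

theorem theorem5:
  fixes X :: "'a metric" and T :: "'a \<Rightarrow> 'a" and C :: "'a set set set"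
  assumes "minimal_system X T"
    and "\<And>Q. Q \<in> C \<Longrightarrow> quasifactor X T Q \<and> Q \<noteq> {mspace X}"
    and "pairwise (\<lambda>Q R. disjoint_systems (submetric (hyperspace X) Q) ((`) T)
                                          (submetric (hyperspace X) R) ((`) T)) C"
  shows "countable C"
proof -
  note min = assms(1)
  have "\<exists>A. A \<in> Q" if "Q \<in> C" for Q
    using assms(2)[OF that] unfolding quasifactor_def by blast
  then obtain a where a: "\<And>Q. Q \<in> C \<Longrightarrow> a Q \<in> Q" by metis
  \<comment> \<open>\<open>I n\<close> collects the \<open>Q\<close> for which no other chosen set lies in the \<open>1/(n+1)\<close>-neighbourhood
      of \<open>a Q\<close>.\<close>
  define I where "I n = {Q \<in> C. \<forall>R\<in>C. R \<noteq> Q \<longrightarrow>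
      (\<exists>y\<in>a R. \<forall>x\<in>a Q. inverse (Suc n) \<le> mdist X x y)}" for n :: nat
  have "finite (I n)" for n
  proof (rule finite_separated_sets[OF minimal_system_compact[OF min]])
    show "0 < inverse (real (Suc n))" by simp
    show "a Q \<subseteq> mspace X" if "Q \<in> I n" for Q
    proof -
      have "Q \<in> C" using that by (simp add: I_def)
      then show ?thesis
        using quasifactor_member(3)[OF min] assms(2) a by blast
    qed
    show "\<exists>y\<in>a R. \<forall>x\<in>a Q. inverse (real (Suc n)) \<le> mdist X x y"
      if "Q \<in> I n" "R \<in> I n" "Q \<noteq> R" for Q R
      using that unfolding I_def by blast
  qed
  moreover have "C \<subseteq> (\<Union>n. I n)"
  proof (rule subsetI, rule ccontr)
    fix Q assume Q: "Q \<in> C" and "Q \<notin> (\<Union>n. I n)"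
    have near: "\<exists>R\<in>C. R \<noteq> Q \<and> (\<forall>y\<in>a R. \<exists>x\<in>a Q. mdist X x y < inverse (Suc n))" for n
    proof -
      have "Q \<notin> I n"
        using \<open>Q \<notin> (\<Union>n. I n)\<close> by blast
      then show ?thesis
        using Q unfolding I_def by (simp only: mem_Collect_eq) (meson not_le)
    qed
    have "a Q = mspace X"
    proof (rule quasifactor_limit_trivial[OF min _ a[OF Q]])
      show "quasifactor X T Q" using assms(2) Q by blast
      fix e :: real assume "e > 0"
      then obtain n where n: "inverse (real (Suc n)) < e"
        using reals_Archimedean by blast
      obtain R where R: "R \<in> C" "R \<noteq> Q" "\<forall>y\<in>a R. \<exists>x\<in>a Q. mdist X x y < inverse (Suc n)"
        using near by blast
      have "\<forall>y\<in>a R. \<exists>x\<in>a Q. mdist X x y < e"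
        using R(3) n by (meson less_trans)
      moreover have "disjoint_systems (submetric (hyperspace X) Q) ((`) T)
                                      (submetric (hyperspace X) R) ((`) T)"
        using pairwiseD[OF assms(3) Q R(1)] R(2) by blast
      ultimately show "\<exists>R C. quasifactor X T R \<and>
          disjoint_systems (submetric (hyperspace X) Q) ((`) T) (submetric (hyperspace X) R) ((`) T) \<and>
          C \<in> R \<and> (\<forall>x\<in>C. \<exists>a\<in>a Q. mdist X a x < e)"
        using assms(2) R(1) a by blast
    qed
    then show False
      using quasifactor_trivial[OF min] a[OF Q] assms(2)[OF Q] by auto
  qed
  ultimately show ?thesis
    by (meson countable_UN countable_finite countable_subset countableI_type)
qed

end
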